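(* Let $d\ge 2$ be an integer and let $f\in\mathcal{SB}_d$ be (the pmf of) a $\Sigma_{cx}$-smallest element in $\mathcal{SB}_d$. Then the coefficients of the polynomial $\mathcal{H}(f)=P(\boldsymbol z)=\sum_{\boldsymbol i\in\mathcal{X}_{d-1}}a_{\boldsymbol i}\boldsymbol z^{\boldsymbol i}$ are such that: (1) $a_{\boldsymbol i}=0$ for every $\boldsymbol i\in\mathcal{X}_{d-1}\setminus\mathscr{I}^{\ast}_{d-1}$; (2) the sum of the coefficients of the monomials of the same order is $0$, i.e. for every integer $k$, $\sum_{\boldsymbol i\in\mathcal{X}_{d-1}:\ i_1+\dots+i_{d-1}=k}a_{\boldsymbol i}=0$; (3) for every $j\in\{1,\dots,d-1\}$, the sum of the coefficients of the monomials containing $z_j$ is $0$, i.e. $\sum_{\boldsymbol i\in\mathcal{X}_{d-1}:\ i_j=1}a_{\boldsymbol i}=0$.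
   Context: $\mathcal{X}_n=\{0,1\}^n$, and $\boldsymbol 1_d$ is the all-ones vector of length $d$. $\mathcal{SB}_d$ is the class of probability mass functions (pmfs) $f:\{0,1\}^d\to[0,1]$ of random vectors $\boldsymbol X=(X_1,\dots,X_d)$ whose one-dimensional marginals are all Bernoulli with mean $1/2$. Convex order: for random variables with finite mean, $Y_1\le_{cx}Y_2$ if $E[\phi(Y_1)]\le E[\phi(Y_2)]$ for all convex $\phi:\mathbb{R}\to\mathbb{R}$ for which the expectations are finite. A random vector $\boldsymbol X$ with pmf in $\mathcal{SB}_d$ (or its pmf) is $\Sigma_{cx}$-smallest in $\mathcal{SB}_d$ if $\sum_{j=1}^dX_j\le_{cx}\sum_{j=1}^dX'_j$ for every random vector $\boldsymbol X'$ with pmf in $\mathcal{SB}_d$. For $\boldsymbol i=(i_1,\dots,i_{d-1})\in\mathcal{X}_{d-1}$ let $\boldsymbol s_{\boldsymbol i}=(i_1,\dots,i_{d-1},0)\in\mathcal{X}_d$ and $\boldsymbol z^{\boldsymbol i}=\prod_{j=1}^{d-1}z_j^{i_j}$. The map $\mathcal{H}$ sends $f\in\mathcal{SB}_d$ to the polynomial $\mathcal{H}(f)=\sum_{\boldsymbol i\in\mathcal{X}_{d-1}}\big(f(\boldsymbol s_{\boldsymbol i})-f(\boldsymbol 1_d-\boldsymbol s_{\boldsymbol i})\big)\boldsymbol z^{\boldsymbol i}$ in the variables $z_1,\dots,z_{d-1}$. Set $M_d=m_d=d/2$ if $d$ is even, and $M_d=(d-1)/2$, $m_d=(d+1)/2$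 if $d$ is odd. $\mathscr{I}^{\ast}_{d-1}=\{\boldsymbol i\in\mathcal{X}_{d-1}:\sum_{h=1}^{d-1}i_h=M_d\text{ or }\sum_{h=1}^{d-1}i_h=m_d\}$. *)

theory Defs
  imports "HOL-Probability.Probability" "HOL-Library.Poly_Mapping"
begin

(* Vectors of length n are functions on {1..n}, extensional (undefined elsewhere), so that each
   element of the cube is represented exactly once. *)
definition cube :: "nat \<Rightarrow> (nat \<Rightarrow> nat) set" where
  "cube n = {1..n} \<rightarrow>\<^sub>E {0, 1}"

definition SB :: "nat \<Rightarrow> (nat \<Rightarrow> nat) pmf set" where
  "SB d = {f. set_pmf f \<subseteq> cube d \<and>
              (\<forall>j\<in>{1..d}. map_pmf (\<lambda>x. x j) f = map_pmf of_bool (bernoulli_pmf (1/2)))}"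

(* The two random variables may live on different probability spaces. *)
definition convex_order ::
    "'a measure \<Rightarrow> ('a \<Rightarrow> real) \<Rightarrow> 'b measure \<Rightarrow> ('b \<Rightarrow> real) \<Rightarrow> bool" where
  "convex_order M Y N Z \<longleftrightarrow>
     integrable M Y \<and> integrable N Z \<and>
     (\<forall>\<phi> :: real \<Rightarrow> real. convex_on UNIV \<phi> \<longrightarrow>
        integrable M (\<lambda>x. \<phi> (Y x)) \<longrightarrow> integrable N (\<lambda>x. \<phi> (Z x)) \<longrightarrow>
        (\<integral>x. \<phi> (Y x) \<partial>M) \<le> (\<integral>x. \<phi> (Z x) \<partial>N))"

definition coord_sum :: "nat \<Rightarrow> (nat \<Rightarrow> nat) \<Rightarrow> nat" where
  "coord_sum n x = (\<Sum>j\<in>{1..n}. x j)"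

(* The convex order depends only on the laws of the sums, so each random vector is represented by
   the identity on the probability space given by its pmf. *)
definition sigma_cx_smallest :: "nat \<Rightarrow> (nat \<Rightarrow> nat) pmf \<Rightarrow> bool" where
  "sigma_cx_smallest d f \<longleftrightarrow> f \<in> SB d \<and>
     (\<forall>f'\<in>SB d. convex_order (measure_pmf f) (\<lambda>x. real (coord_sum d x))
                             (measure_pmf f') (\<lambda>x. real (coord_sum d x)))"

definition s_vec :: "nat \<Rightarrow> (nat \<Rightarrow> nat) \<Rightarrow> (nat \<Rightarrow> nat)" where
  "s_vec d i = (\<lambda>j\<in>{1..d}. if j = d then 0 else i j)"

definition ones_minus :: "nat \<Rightarrow> (nat \<Rightarrow> nat) \<Rightarrow> (nat \<Rightarrow> nat)" where
  "ones_minus d x = (\<lambda>j\<in>{1..d}. 1 - x j)"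

(* Real polynomials in the variables z_j, as finitely supported maps from exponents (themselves
   finitely supported maps from variable indices to degrees) to coefficients; the ring structure
   is the convolution product of Poly_Mapping. *)
type_synonym mpolynomial = "(nat \<Rightarrow>\<^sub>0 nat) \<Rightarrow>\<^sub>0 real"

definition const :: "real \<Rightarrow> mpolynomial" where
  "const c = Poly_Mapping.single 0 c"

definition var :: "nat \<Rightarrow> mpolynomial" where
  "var j = Poly_Mapping.single (Poly_Mapping.single j 1) 1"

definition H :: "nat \<Rightarrow> (nat \<Rightarrow> nat) pmf \<Rightarrow> mpolynomial" where
  "H d f = (\<Sum>i\<in>cube (d - 1).
     const (pmf f (s_vec d i) - pmf f (ones_minus d (s_vec d i))) *
     (\<Prod>j\<in>{1..d - 1}. var j ^ i j))"

definition expo :: "nat \<Rightarrow> (nat \<Rightarrow> nat) \<Rightarrow> (nat \<Rightarrow>\<^sub>0 nat)" where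
  "expo n i = (\<Sum>j\<in>{1..n}. Poly_Mapping.single j (i j))"

(* The coefficient of the monomial z_1^(i_1) ... z_n^(i_n). *)
definition coefficient :: "nat \<Rightarrow> mpolynomial \<Rightarrow> (nat \<Rightarrow> nat) \<Rightarrow> real" where
  "coefficient n P i = Poly_Mapping.lookup P (expo n i)"

definition M_idx :: "nat \<Rightarrow> nat" where
  "M_idx d = (if even d then d div 2 else (d - 1) div 2)"

definition m_idx :: "nat \<Rightarrow> nat" where
  "m_idx d = (if even d then d div 2 else (d + 1) div 2)"

(* The index set I*_(d-1), as a function of d. *)
definition I_star :: "nat \<Rightarrow> (nat \<Rightarrow> nat) set" where
  "I_star d = {i \<in> cube (d - 1). coord_sum (d - 1) i = M_idx d \<or> coord_sum (d - 1) i = m_idx d}"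

end

theory Submission
  imports Defs
begin

text \<open>
  The vector \<open>h\<close> with \<open>d div 2\<close> ones and its complement, each taken with probability 1/2, form an
  element of \<open>\<S>\<B>\<^sub>d\<close> whose sum has distance to \<open>d/2\<close> as small as an integer can have. Comparing the
  expectations of the convex function \<open>y \<mapsto> \<bar>y - d/2\<bar>\<close> shows that a smallest element has its sum in
  \<open>{M\<^sub>d, m\<^sub>d}\<close> almost surely, which is (1). Claim (3) reads
  \<open>P(X\<^sub>j = 1, X\<^sub>d = 0) = P(X\<^sub>j = 0, X\<^sub>d = 1)\<close>, which only uses the marginals. For (2), let \<open>A\<^sub>k\<close> be the sum
  of the coefficients of order \<open>k\<close>. Then \<open>\<Sum>\<^sub>k A\<^sub>k = P(X\<^sub>d = 0) - P(X\<^sub>d = 1) = 0\<close>, and summing (3)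
  over \<open>j\<close> gives \<open>\<Sum>\<^sub>k k A\<^sub>k = 0\<close>. Only \<open>A\<close> at \<open>M\<^sub>d\<close> and \<open>m\<^sub>d\<close> can be nonzero, so both vanish.
\<close>

section \<open>The coefficients of the polynomial\<close>

lemma finite_cube: "finite (cube n)"
  unfolding cube_def by (intro finite_PiE) auto

lemma cube_value: "x \<in> cube n \<Longrightarrow> j \<in> {1..n} \<Longrightarrow> x j = 0 \<or> x j = 1"
  unfolding cube_def using PiE_mem[of x "{1..n}" "\<lambda>_. {0, 1}" j] by simp

lemma cube_eqI:
  assumes "x \<in> cube n" "y \<in> cube n" "\<And>j. j \<in> {1..n} \<Longrightarrow> x j = y j"
  shows "x = y"
  using assms unfolding cube_def by (metis PiE_ext)

lemma lookup_expo: "j \<in> {1..n} \<Longrightarrow> Poly_Mapping.lookup (expo n i) j = i j"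
  unfolding expo_def by (simp add: lookup_sum lookup_single when_def)

text \<open>The degree in \<open>z_j\<close> recovers \<open>i j\<close>. Hence each coefficient of
  \<open>H\<close> comes from a single summand.\<close>

lemma inj_on_expo: "inj_on (expo n) (cube n)"
proof (rule inj_onI)
  fix x y assume xy: "x \<in> cube n" "y \<in> cube n" and eq: "expo n x = expo n y"
  from xy show "x = y"
  proof (rule cube_eqI)
    fix j assume j: "j \<in> {1..n}"
    show "x j = y j"
      using lookup_expo[OF j, of x] lookup_expo[OF j, of y] eq by simp
  qed
qed

lemma var_power: "var j ^ k = Poly_Mapping.single (Poly_Mapping.single j k) 1"
proof (induction k)
  case (Suc k)
  then show ?case
    by (simp add: var_def mult_single flip: single_add)
qed simp

lemma monomial_eq_single: "(\<Prod>j\<in>{1..n}. var j ^ i j) = Poly_Mapping.single (expo n i) 1"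
proof -
  have "(\<Prod>j\<in>J. var j ^ i j) = Poly_Mapping.single (\<Sum>j\<in>J. Poly_Mapping.single j (i j)) 1"
    if "finite J" for J
    using that by induction (simp_all add: var_power mult_single)
  then show ?thesis
    by (simp add: expo_def)
qed

text \<open>Scalar attached to \<open>i\<close> in \<open>H\<close>. Through
  \<open>coefficient_H\<close> the rest of the argument deals with probabilities instead of
  polynomials.\<close>

definition coef :: "nat \<Rightarrow> (nat \<Rightarrow> nat) pmf \<Rightarrow> (nat \<Rightarrow> nat) \<Rightarrow> real" where
  "coef d f i = pmf f (s_vec d i) - pmf f (ones_minus d (s_vec d i))"

lemma coefficient_H:
  assumes "i \<in> cube (d - 1)"
  shows "coefficient (d - 1) (H d f) i = coef d f i"
proof -
  have "coefficient (d - 1) (H d f) i =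
      (\<Sum>i'\<in>cube (d - 1). coef d f i' when expo (d - 1) i' = expo (d - 1) i)"
    by (simp add: coefficient_def H_def monomial_eq_single const_def mult_single
        lookup_sum lookup_single coef_def del: One_nat_def)
  also have "\<dots> = (\<Sum>i'\<in>cube (d - 1). if i' = i then coef d f i' else 0)"
    using assms by (intro sum.cong) (auto simp: when_def dest: inj_onD[OF inj_on_expo])
  finally show ?thesis
    using assms by (simp add: finite_cube)
qed

lemma sum_coefficient_H:
  assumes "A \<subseteq> cube (d - 1)"
  shows "(\<Sum>i\<in>A. coefficient (d - 1) (H d f) i) = (\<Sum>i\<in>A. coef d f i)"
  using assms by (intro sum.cong refl coefficient_H) blast

section \<open>Sums of coefficients as probabilities\<close>

lemma s_vec_apply: "j \<in> {1..d - 1} \<Longrightarrow> s_vec d i j = i j"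
  by (auto simp: s_vec_def)

lemma s_vec_last: "d \<ge> 1 \<Longrightarrow> s_vec d i d = 0"
  by (auto simp: s_vec_def)

lemma ones_minus_apply: "j \<in> {1..d} \<Longrightarrow> ones_minus d x j = 1 - x j"
  by (auto simp: ones_minus_def)

lemma s_vec_in_cube: "i \<in> cube (d - 1) \<Longrightarrow> s_vec d i \<in> cube d"
  by (fastforce simp: cube_def s_vec_def PiE_iff)

lemma ones_minus_in_cube: "x \<in> cube d \<Longrightarrow> ones_minus d x \<in> cube d"
  by (fastforce simp: cube_def ones_minus_def PiE_iff)

lemma ones_minus_ones_minus:
  assumes x: "x \<in> cube d"
  shows "ones_minus d (ones_minus d x) = x"
  using ones_minus_in_cube[OF ones_minus_in_cube[OF x]] x
proof (rule cube_eqI)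
  fix j assume j: "j \<in> {1..d}"
  show "ones_minus d (ones_minus d x) j = x j"
    using cube_value[OF x j] by (auto simp only: ones_minus_apply[OF j])
qed

lemma inj_on_ones_minus: "inj_on (ones_minus d) (cube d)"
  by (rule inj_on_inverseI[where g = "ones_minus d"]) (rule ones_minus_ones_minus)

lemma inj_on_s_vec: "inj_on (s_vec d) (cube (d - 1))"
proof (rule inj_onI)
  fix x y assume xy: "x \<in> cube (d - 1)" "y \<in> cube (d - 1)" and eq: "s_vec d x = s_vec d y"
  from xy show "x = y"
  proof (rule cube_eqI)
    fix j assume j: "j \<in> {1..d - 1}"
    show "x j = y j"
      using s_vec_apply[OF j, of x] s_vec_apply[OF j, of y] eq by simp
  qed
qed

text \<open>Restriction inverts \<open>s_vec d\<close> on the face \<open>x d = 0\<close>, which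
  yields surjectivity onto that face in \<open>s_vec_image\<close>.\<close>

lemma s_vec_restrict:
  assumes "x \<in> cube d" "x d = 0"
  shows "restrict x {1..d - 1} \<in> cube (d - 1)" "s_vec d (restrict x {1..d - 1}) = x"
proof -
  show *: "restrict x {1..d - 1} \<in> cube (d - 1)"
    unfolding cube_def
  proof (rule PiE_I)
    fix j assume "j \<in> {1..d - 1}"
    then show "restrict x {1..d - 1} j \<in> {0, 1}"
      using cube_value[OF assms(1), of j] by auto
  qed auto
  show "s_vec d (restrict x {1..d - 1}) = x"
    using s_vec_in_cube[OF *] assms(1)
  proof (rule cube_eqI)
    fix j assume j: "j \<in> {1..d}"
    show "s_vec d (restrict x {1..d - 1}) j = x j"
      using j assms(2) by (cases "j = d") (auto simp: s_vec_def)
  qed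
qed

lemma s_vec_image:
  assumes d: "d \<ge> 1" and Q: "\<And>x. x \<in> cube d \<Longrightarrow> P (restrict x {1..d - 1}) \<longleftrightarrow> Q x"
  shows "s_vec d ` {i \<in> cube (d - 1). P i} = {x \<in> cube d. x d = 0 \<and> Q x}"
proof (intro equalityI subsetI)
  fix x assume "x \<in> s_vec d ` {i \<in> cube (d - 1). P i}"
  then obtain i where i: "i \<in> cube (d - 1)" "P i" "x = s_vec d i"
    by auto
  have x: "x \<in> cube d" "x d = 0"
    using s_vec_in_cube[OF i(1)] s_vec_last[OF d] i(3) by auto
  have "restrict x {1..d - 1} = i"
    using s_vec_restrict(1)[OF x] i(1)
  proof (rule cube_eqI)
    fix j assume "j \<in> {1..d - 1}"
    then show "restrict x {1..d - 1} j = i j"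
      by (simp only: i(3) s_vec_apply restrict_apply')
  qed
  then show "x \<in> {x \<in> cube d. x d = 0 \<and> Q x}"
    using Q[OF x(1)] i(2) x by simp
next
  fix x assume "x \<in> {x \<in> cube d. x d = 0 \<and> Q x}"
  then have x: "x \<in> cube d" "x d = 0" "Q x"
    by auto
  have "restrict x {1..d - 1} \<in> {i \<in> cube (d - 1). P i}"
    using s_vec_restrict(1)[OF x(1,2)] Q[OF x(1)] x(3) by blast
  then show "x \<in> s_vec d ` {i \<in> cube (d - 1). P i}"
    using s_vec_restrict(2)[OF x(1,2)] by (metis image_eqI)
qed

lemma sum_pmf_inj_on:
  assumes "finite A" "inj_on g A"
  shows "(\<Sum>i\<in>A. pmf f (g i)) = measure f (g ` A)"
  using assms by (simp add: measure_measure_pmf_finite sum.reindex)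

text \<open>\<open>s_vec d\<close> maps the index set injectively into the face
  \<open>x d = 0\<close>, and complementation carries the image into the face
  \<open>x d = 1\<close>. Each of the two sums of point masses is therefore the probability of an
  event; \<open>Q\<close> is \<open>P\<close> read on the first \<open>d - 1\<close>
  coordinates.\<close>

lemma sum_coef:
  assumes f: "set_pmf f \<subseteq> cube d" and d: "d \<ge> 1"
    and Q: "\<And>x. x \<in> cube d \<Longrightarrow> P (restrict x {1..d - 1}) \<longleftrightarrow> Q x"
  shows "(\<Sum>i\<in>{i \<in> cube (d - 1). P i}. coef d f i) =
    measure f {x. x d = 0 \<and> Q x} - measure f {x. x d = 1 \<and> Q (ones_minus d x)}"
proof -
  let ?A = "{i \<in> cube (d - 1). P i}"
  have A: "finite ?A" "?A \<subseteq> cube (d - 1)"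
    using finite_cube by auto
  have inj: "inj_on (s_vec d) ?A"
    using inj_on_s_vec A(2) by (rule inj_on_subset)
  have sub: "s_vec d ` ?A \<subseteq> cube d"
    using s_vec_in_cube by auto
  have inj': "inj_on (\<lambda>i. ones_minus d (s_vec d i)) ?A"
    using comp_inj_on[OF inj inj_on_subset[OF inj_on_ones_minus sub]] by (simp add: comp_def)
  \<comment> \<open>\<open>f\<close> is supported on the cube, so events need not mention
    it.\<close>
  have *: "measure f {x \<in> cube d. R x} = measure f {x. R x}" for R
    using f by (intro measure_pmf.finite_measure_eq_AE) (auto simp: AE_measure_pmf_iff)
  have image: "s_vec d ` ?A = {x \<in> cube d. x d = 0 \<and> Q x}"
    using d Q by (rule s_vec_image)
  have image': "(\<lambda>i. ones_minus d (s_vec d i)) ` ?A =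
      {x \<in> cube d. x d = 1 \<and> Q (ones_minus d x)}"
  proof -
    have "(\<lambda>i. ones_minus d (s_vec d i)) ` ?A = ones_minus d ` s_vec d ` ?A"
      by (simp add: image_image)
    also have "\<dots> = ones_minus d ` {x \<in> cube d. x d = 0 \<and> Q x}"
      by (simp only: image)
    also have "\<dots> = {x \<in> cube d. x d = 1 \<and> Q (ones_minus d x)}"
    proof (intro equalityI subsetI)
      fix x assume x: "x \<in> {x \<in> cube d. x d = 1 \<and> Q (ones_minus d x)}"
      \<comment> \<open>Complementation is an involution, so \<open>ones_minus d x\<close> is the
        preimage of \<open>x\<close>.\<close>
      then show "x \<in> ones_minus d ` {x \<in> cube d. x d = 0 \<and> Q x}"
        using d by (intro image_eqI[of _ _ "ones_minus d x"])
          (auto simp: ones_minus_ones_minus ones_minus_in_cube ones_minus_apply)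
    qed (use d in \<open>auto simp: ones_minus_ones_minus ones_minus_in_cube ones_minus_apply\<close>)
    finally show ?thesis .
  qed
  show ?thesis
    unfolding coef_def sum_subtractf sum_pmf_inj_on[OF A(1) inj] sum_pmf_inj_on[OF A(1) inj']
      image image' * ..
qed

section \<open>Fair marginals and the sums over monomials containing a variable\<close>

lemma SB_set_pmf: "f \<in> SB d \<Longrightarrow> set_pmf f \<subseteq> cube d"
  by (simp add: SB_def)

lemma SB_marginal:
  assumes "f \<in> SB d" "j \<in> {1..d}"
  shows "measure f {x. x j = 1} = 1/2" "measure f {x. x j = 0} = 1/2"
proof -
  have eq: "map_pmf (\<lambda>x. x j) f = map_pmf of_bool (bernoulli_pmf (1/2))"
    using assms by (auto simp: SB_def)
  have "measure f {x. x j = v} = measure (map_pmf (\<lambda>x. x j) f) {v}" for v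
    by (simp only: measure_map_pmf) (simp add: vimage_def)
  moreover have "(of_bool -` {Suc 0} :: bool set) = {True}" "(of_bool -` {0::nat}) = {False}"
    by (auto simp: of_bool_def split: if_splits)
  ultimately show "measure f {x. x j = 1} = 1/2" "measure f {x. x j = 0} = 1/2"
    unfolding eq by (simp_all add: measure_pmf_single pmf_map)
qed

lemma sum_coef_all:
  assumes "f \<in> SB d" "d \<ge> 1"
  shows "(\<Sum>i\<in>cube (d - 1). coef d f i) = 0"
  using sum_coef[of f d "\<lambda>_. True" "\<lambda>_. True"] assms
  by (simp add: SB_set_pmf SB_marginal del: One_nat_def)

lemma sum_coef_containing:
  assumes f: "f \<in> SB d" and j: "j \<in> {1..d - 1}"
  shows "(\<Sum>i\<in>{i \<in> cube (d - 1). i j = 1}. coef d f i) = 0"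
proof -
  have jd: "j \<in> {1..d}" "d \<in> {1..d}" "d \<ge> 1"
    using j by auto
  have 01: "x k = 0 \<or> x k = 1" if "x \<in> set_pmf f" "k \<in> {1..d}" for x k
    using that SB_set_pmf[OF f] cube_value by blast
  \<comment> \<open>Used with \<open>(l, k)\<close> equal to \<open>(j, d)\<close> and to
    \<open>(d, j)\<close>: the probability that both coordinates are 1 is common and cancels in the
    difference.\<close>
  have split: "measure f {x. x k = 1} =
      measure f {x. x l = 0 \<and> x k = 1} + measure f {x. x l = 1 \<and> x k = 1}"
    if "l \<in> {1..d}" for k l
  proof -
    have "measure f {x. x k = 1} = measure f ({x. x l = 0 \<and> x k = 1} \<union> {x. x l = 1 \<and> x k = 1})"
      using 01[OF _ that]
      by (intro measure_pmf.finite_measure_eq_AE) (auto simp: AE_measure_pmf_iff)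
    also have "\<dots> = measure f {x. x l = 0 \<and> x k = 1} + measure f {x. x l = 1 \<and> x k = 1}"
      by (intro measure_pmf.finite_measure_Union) auto
    finally show ?thesis .
  qed
  have "(\<Sum>i\<in>{i \<in> cube (d - 1). i j = 1}. coef d f i) =
    measure f {x. x d = 0 \<and> x j = 1} - measure f {x. x d = 1 \<and> ones_minus d x j = 1}"
    by (rule sum_coef[OF SB_set_pmf[OF f] jd(3)]) (use j in auto)
  also have "measure f {x. x d = 1 \<and> ones_minus d x j = 1} = measure f {x. x j = 0 \<and> x d = 1}"
    using 01 jd
    by (intro measure_pmf.finite_measure_eq_AE) (force simp: AE_measure_pmf_iff ones_minus_apply)+
  also have "measure f {x. x d = 0 \<and> x j = 1} - \<dots> = measure f {x. x j = 1} - measure f {x. x d = 1}"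
    using split[OF jd(1), of d] split[OF jd(2), of j] by (simp add: conj_commute)
  also have "\<dots> = 0"
    using SB_marginal(1)[OF f jd(1)] SB_marginal(1)[OF f jd(2)] by simp
  finally show ?thesis .
qed

section \<open>The sum of a smallest element\<close>

lemma coord_sum_ones_minus:
  assumes "x \<in> cube d"
  shows "coord_sum d (ones_minus d x) + coord_sum d x = d"
proof -
  have "coord_sum d (ones_minus d x) + coord_sum d x = (\<Sum>j\<in>{1..d}. 1)"
    unfolding coord_sum_def sum.distrib[symmetric]
    using assms by (intro sum.cong) (auto simp: ones_minus_apply dest: cube_value)
  then show ?thesis by simp
qed

lemma coord_sum_s_vec: "d \<ge> 1 \<Longrightarrow> coord_sum d (s_vec d i) = coord_sum (d - 1) i"
  unfolding coord_sum_def by (cases d) (auto simp: s_vec_def)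

section \<open>The competing pmf, concentrated on two complementary vectors\<close>

definition half_vec :: "nat \<Rightarrow> nat \<Rightarrow> nat" where
  "half_vec d = (\<lambda>j\<in>{1..d}. of_bool (j \<le> d div 2))"

lemma half_vec_in_cube: "half_vec d \<in> cube d"
  by (auto simp: half_vec_def cube_def)

lemma coord_sum_half_vec: "coord_sum d (half_vec d) = d div 2"
proof -
  have "coord_sum d (half_vec d) = (\<Sum>j\<in>{1..d}. if j \<in> {1..d div 2} then 1 else 0)"
    unfolding coord_sum_def by (intro sum.cong) (auto simp: half_vec_def)
  also have "\<dots> = card ({1..d} \<inter> {1..d div 2})"
    by (simp only: sum.If_cases[OF finite_atLeastAtMost] Collect_mem_eq) simp
  also have "{1..d} \<inter> {1..d div 2} = {1..d div 2}"
    by auto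
  finally show ?thesis by simp
qed

definition half_pmf :: "nat \<Rightarrow> (nat \<Rightarrow> nat) pmf" where
  "half_pmf d = map_pmf (\<lambda>b. if b then half_vec d else ones_minus d (half_vec d))
     (bernoulli_pmf (1/2))"

text \<open>Each coordinate is the fair coin itself, for \<open>j \<le> d div 2\<close>, or its
  negation, which has the same law.\<close>

lemma half_pmf_in_SB: "half_pmf d \<in> SB d"
proof -
  have not: "map_pmf Not (bernoulli_pmf (1/2)) = bernoulli_pmf (1/2)"
  proof (rule pmf_eqI)
    fix b
    \<comment> \<open>The form \<open>Not (\<not> b)\<close> exhibits the argument as a value of the
      injective map \<open>Not\<close>.\<close>
    have "pmf (map_pmf Not (bernoulli_pmf (1/2))) (Not (\<not> b)) = pmf (bernoulli_pmf (1/2)) (\<not> b)"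
      by (rule pmf_map_inj') (auto simp: inj_def)
    then show "pmf (map_pmf Not (bernoulli_pmf (1/2))) b = pmf (bernoulli_pmf (1/2)) b"
      by (cases b) simp_all
  qed
  have "map_pmf (\<lambda>x. x j) (half_pmf d) = map_pmf of_bool (bernoulli_pmf (1/2))"
    if j: "j \<in> {1..d}" for j
  proof (cases "j \<le> d div 2")
    case True
    have "map_pmf (\<lambda>x. x j) (half_pmf d) = map_pmf of_bool (bernoulli_pmf (1/2))"
      unfolding half_pmf_def map_pmf_comp
      by (intro map_pmf_cong) (use j True in \<open>auto simp: half_vec_def ones_minus_def\<close>)
    then show ?thesis .
  next
    case False
    have "map_pmf (\<lambda>x. x j) (half_pmf d) = map_pmf (\<lambda>b. of_bool (\<not> b)) (bernoulli_pmf (1/2))"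
      unfolding half_pmf_def map_pmf_comp
      by (intro map_pmf_cong) (use j False in \<open>auto simp: half_vec_def ones_minus_def\<close>)
    also have "\<dots> = map_pmf of_bool (map_pmf Not (bernoulli_pmf (1/2)))"
      by (simp add: map_pmf_comp)
    finally show ?thesis
      by (simp add: not)
  qed
  moreover have "set_pmf (half_pmf d) \<subseteq> cube d"
    by (auto simp: half_pmf_def half_vec_in_cube ones_minus_in_cube)
  ultimately show ?thesis
    by (simp add: SB_def)
qed

text \<open>The two atoms have sums \<open>d div 2\<close> and \<open>d - d div 2\<close>, symmetric
  about \<open>d / 2\<close>. The deviation is 0 for even \<open>d\<close> and 1/2 for odd
  \<open>d\<close>.\<close>

lemma half_pmf_deviation:
  assumes "x \<in> set_pmf (half_pmf d)"
  shows "\<bar>real (coord_sum d x) - real d / 2\<bar> = real d / 2 - real (d div 2)"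
proof -
  have "coord_sum d (ones_minus d (half_vec d)) = d - d div 2"
    using coord_sum_ones_minus[OF half_vec_in_cube, of d] by (simp add: coord_sum_half_vec)
  moreover have "real (d div 2) \<le> real d / 2"
    by linarith
  ultimately show ?thesis
    using assms by (auto simp: half_pmf_def coord_sum_half_vec split: if_splits)
qed

text \<open>For even \<open>d\<close> the left side is 0; for odd \<open>d\<close> the centre is a
  half-integer, at distance at least 1/2 from every integer.\<close>

lemma integer_deviation: "real d / 2 - real (d div 2) \<le> \<bar>real n - real d / 2\<bar>"
proof (cases "even d")
  case True
  then show ?thesis by (auto elim!: evenE)
next
  case False
  then obtain k where "d = 2 * k + 1" by (elim oddE)
  then show ?thesis by (cases "n \<le> k") (auto simp: field_simps)
qed

text \<open>This form and the one for \<open>m_idx\<close> avoid the parity split and show that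
  \<open>k \<mapsto> d - k\<close> exchanges the two values.\<close>

lemma M_idx_eq: "M_idx d = d div 2"
  by (cases "even d") (auto simp: M_idx_def elim!: oddE)

lemma m_idx_eq: "m_idx d = d - d div 2"
  by (cases "even d") (auto simp: m_idx_def elim!: evenE oddE)

text \<open>A nonnegative function with expectation at most 0 vanishes almost surely, hence, for a
  pmf, on the whole support. The function here is the excess of the deviation over its least
  possible value \<open>?c\<close>.\<close>

lemma smallest_coord_sum:
  assumes "sigma_cx_smallest d f" "x \<in> set_pmf f"
  shows "coord_sum d x = M_idx d \<or> coord_sum d x = m_idx d"
proof -
  let ?\<phi> = "\<lambda>y::real. \<bar>y - real d / 2\<bar>"
  let ?S = "\<lambda>x. real (coord_sum d x)"
  let ?c = "real d / 2 - real (d div 2)"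
  have f: "f \<in> SB d"
    using assms by (simp add: sigma_cx_smallest_def)
  \<comment> \<open>Finite support makes every function integrable, which settles the side
    conditions of \<open>convex_order\<close>.\<close>
  have int: "integrable (measure_pmf g) h" if "g \<in> SB d" for g and h :: "_ \<Rightarrow> real"
    using finite_subset[OF SB_set_pmf[OF that] finite_cube]
    by (rule integrable_measure_pmf_finite)
  have convex: "convex_on UNIV ?\<phi>"
    using convex_on_dist[OF convex_UNIV, of "real d / 2"]
    by (simp add: dist_real_def abs_minus_commute)
  have "measure_pmf.expectation f (\<lambda>x. ?\<phi> (?S x)) \<le>
      measure_pmf.expectation (half_pmf d) (\<lambda>x. ?\<phi> (?S x))"
    using assms(1) convex int[OF f] int[OF half_pmf_in_SB] half_pmf_in_SB[of d]
    unfolding sigma_cx_smallest_def convex_order_def by blast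
  also have "\<dots> = measure_pmf.expectation (half_pmf d) (\<lambda>_. ?c)"
    by (intro integral_cong_AE) (auto simp: AE_measure_pmf_iff half_pmf_deviation)
  finally have "measure_pmf.expectation f (\<lambda>x. ?\<phi> (?S x) - ?c) \<le> 0"
    using int[OF f] by simp
  moreover have "measure_pmf.expectation f (\<lambda>x. ?\<phi> (?S x) - ?c) \<ge> 0"
    using integer_deviation by (intro integral_nonneg_AE) auto
  ultimately have "measure_pmf.expectation f (\<lambda>x. ?\<phi> (?S x) - ?c) = 0"
    by linarith
  then have "AE x in measure_pmf f. ?\<phi> (?S x) - ?c = 0"
    by (subst (asm) integral_nonneg_eq_0_iff_AE) (use int[OF f] integer_deviation in auto)
  then have "?\<phi> (?S x) = ?c"
    using assms(2) by (simp add: AE_measure_pmf_iff)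
  then have "?S x = real (d div 2) \<or> ?S x = real d - real (d div 2)"
    by (simp add: abs_if field_simps split: if_splits)
  \<comment> \<open>The subtraction on naturals does not truncate, since
    \<open>d div 2 \<le> d\<close>.\<close>
  then have "coord_sum d x = d div 2 \<or> coord_sum d x = d - d div 2"
    by (simp only: of_nat_eq_iff flip: of_nat_diff[OF div_le_dividend])
  then show ?thesis
    by (simp only: M_idx_eq m_idx_eq)
qed

section \<open>Vanishing of single coefficients and of the sums by order\<close>

lemma coef_outside:
  assumes "d \<ge> 1" "sigma_cx_smallest d f" "i \<in> cube (d - 1) - I_star d"
  shows "coef d f i = 0"
proof -
  have sum: "coord_sum d (s_vec d i) \<noteq> M_idx d" "coord_sum d (s_vec d i) \<noteq> m_idx d"
    using assms by (auto simp: coord_sum_s_vec I_star_def)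
  moreover have "coord_sum d (ones_minus d (s_vec d i)) + coord_sum d (s_vec d i) = d"
    using assms by (intro coord_sum_ones_minus s_vec_in_cube) auto
  \<comment> \<open>The two admissible sums are exchanged by \<open>k \<mapsto> d - k\<close>, so
    the complement of \<open>s_vec d i\<close> has an inadmissible sum as well.\<close>
  ultimately have "s_vec d i \<notin> set_pmf f" "ones_minus d (s_vec d i) \<notin> set_pmf f"
    using smallest_coord_sum[OF assms(2)] unfolding M_idx_eq m_idx_eq by fastforce+
  then show ?thesis
    by (simp add: coef_def set_pmf_iff)
qed

lemma sum_coef_order:
  assumes d: "d \<ge> 1" and f: "sigma_cx_smallest d f"
  shows "(\<Sum>i\<in>{i \<in> cube (d - 1). coord_sum (d - 1) i = k}. coef d f i) = 0"
proof -
  let ?C = "cube (d - 1)" and ?s = "coord_sum (d - 1)"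
  have SB: "f \<in> SB d"
    using f by (simp add: sigma_cx_smallest_def)
  have 0: "coef d f i = 0" if "i \<in> ?C" "?s i \<noteq> M_idx d" "?s i \<noteq> m_idx d" for i
    using coef_outside[OF d f, of i] that by (auto simp: I_star_def)
  \<comment> \<open>Double counting: \<open>i\<close> is counted once for each variable in its
    monomial.\<close>
  have "(\<Sum>i\<in>?C. real (?s i) * coef d f i) = (\<Sum>j\<in>{1..d - 1}. \<Sum>i\<in>?C. real (i j) * coef d f i)"
    unfolding coord_sum_def of_nat_sum sum_distrib_right by (rule sum.swap)
  also have "\<dots> = (\<Sum>j\<in>{1..d - 1}. \<Sum>i\<in>{i \<in> ?C. i j = 1}. coef d f i)"
  proof (rule sum.cong[OF refl])
    fix j assume "j \<in> {1..d - 1}"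
    then have "\<forall>i\<in>?C - {i \<in> ?C. i j = 1}. real (i j) * coef d f i = 0"
      using cube_value by fastforce
    then show "(\<Sum>i\<in>?C. real (i j) * coef d f i) = (\<Sum>i\<in>{i \<in> ?C. i j = 1}. coef d f i)"
      by (intro sum.mono_neutral_cong_right) (auto simp: finite_cube)
  qed
  also have "\<dots> = 0"
    using sum_coef_containing[OF SB] by simp
  finally have weighted: "(\<Sum>i\<in>?C. real (?s i) * coef d f i) = 0" .
  \<comment> \<open>The order may be recentred at any \<open>c\<close>, because the total and the
    first moment both vanish.\<close>
  have lin: "(\<Sum>i\<in>?C. (real (?s i) - c) * coef d f i) = 0" for c
    using weighted sum_coef_all[OF SB d]
    by (simp add: left_diff_distrib sum_subtractf flip: sum_distrib_left)
  have m: "m_idx d = M_idx d \<or> m_idx d = M_idx d + 1"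
    by (cases "even d") (auto simp: M_idx_def m_idx_def elim!: oddE)
  consider "k \<noteq> M_idx d" "k \<noteq> m_idx d" | "m_idx d = M_idx d" "k = M_idx d"
    | "m_idx d = M_idx d + 1" "k = M_idx d" | "m_idx d = M_idx d + 1" "k = m_idx d"
    using m by auto
  \<comment> \<open>Where \<open>coef\<close> is nonzero, the order takes at most two values, and
    these are consecutive. On them the indicator of \<open>k\<close> is an affine function of the
    order, written about \<open>M_idx d\<close>.\<close>
  then have "\<exists>a b. \<forall>i\<in>?C. (if ?s i = k then coef d f i else 0) =
      a * coef d f i + b * ((real (?s i) - real (M_idx d)) * coef d f i)"
  proof cases
    case 1
    then show ?thesis using 0 by (intro exI[of _ 0]) auto
  next
    case 2
    then show ?thesis using 0 by (intro exI[of _ 1] exI[of _ 0]) auto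
  next
    case 3
    \<comment> \<open>Lower order, odd \<open>d\<close>: \<open>1 - (s - M)\<close> is 1 at
      \<open>M\<close> and 0 at \<open>M + 1\<close>.\<close>
    have "(if ?s i = k then coef d f i else 0) =
        1 * coef d f i + (-1) * ((real (?s i) - real (M_idx d)) * coef d f i)" if "i \<in> ?C" for i
      using 3 0[OF that] by (cases "?s i = M_idx d"; cases "?s i = m_idx d") auto
    then show ?thesis by blast
  next
    case 4
    \<comment> \<open>Upper order, odd \<open>d\<close>: \<open>s - M\<close> is 0 at
      \<open>M\<close> and 1 at \<open>M + 1\<close>.\<close>
    have "(if ?s i = k then coef d f i else 0) =
        0 * coef d f i + 1 * ((real (?s i) - real (M_idx d)) * coef d f i)" if "i \<in> ?C" for i
      using 4 0[OF that] by (cases "?s i = M_idx d"; cases "?s i = m_idx d") auto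
    then show ?thesis by blast
  qed
  then obtain a b where ab: "\<And>i. i \<in> ?C \<Longrightarrow> (if ?s i = k then coef d f i else 0) =
      a * coef d f i + b * ((real (?s i) - real (M_idx d)) * coef d f i)"
    by blast
  have "(\<Sum>i\<in>{i \<in> ?C. ?s i = k}. coef d f i) = (\<Sum>i\<in>?C. if ?s i = k then coef d f i else 0)"
    by (rule sum.inter_filter[OF finite_cube])
  also have "\<dots> = (\<Sum>i\<in>?C. a * coef d f i + b * ((real (?s i) - real (M_idx d)) * coef d f i))"
    using ab by (intro sum.cong) auto
  also have "\<dots> = a * (\<Sum>i\<in>?C. coef d f i) + b * (\<Sum>i\<in>?C. (real (?s i) - real (M_idx d)) * coef d f i)"
    by (simp add: sum.distrib sum_distrib_left)
  finally show ?thesis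
    by (simp add: lin sum_coef_all[OF SB d] del: One_nat_def)
qed

theorem theorem3p1:
  fixes d :: nat and f :: "(nat \<Rightarrow> nat) pmf"
  assumes "d \<ge> 2" and "sigma_cx_smallest d f"
  shows "(\<forall>i \<in> cube (d - 1) - I_star d. coefficient (d - 1) (H d f) i = 0) \<and>
    (\<forall>k :: int. (\<Sum>i\<in>{i \<in> cube (d - 1). int (coord_sum (d - 1) i) = k}.
        coefficient (d - 1) (H d f) i) = 0) \<and>
    (\<forall>j \<in> {1..d - 1}. (\<Sum>i\<in>{i \<in> cube (d - 1). i j = 1}.
        coefficient (d - 1) (H d f) i) = 0)"
proof (intro conjI ballI allI)
  fix i assume "i \<in> cube (d - 1) - I_star d"
  then show "coefficient (d - 1) (H d f) i = 0"
    using assms by (simp add: coefficient_H coef_outside del: One_nat_def)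
next
  fix k :: int
  show "(\<Sum>i\<in>{i \<in> cube (d - 1). int (coord_sum (d - 1) i) = k}.
        coefficient (d - 1) (H d f) i) = 0"
  \<comment> \<open>Orders are natural numbers: a negative \<open>k\<close> selects no index, and
    otherwise \<open>nat k\<close> replaces \<open>k\<close>.\<close>
  proof (cases "k < 0")
    case True
    then have "{i \<in> cube (d - 1). int (coord_sum (d - 1) i) = k} = {}"
      by auto
    then show ?thesis by (simp only: sum.empty)
  next
    case False
    then have "{i \<in> cube (d - 1). int (coord_sum (d - 1) i) = k} =
        {i \<in> cube (d - 1). coord_sum (d - 1) i = nat k}"
      by auto
    then show ?thesis
      using assms by (simp add: sum_coefficient_H sum_coef_order del: One_nat_def)
  qed
next
  fix j assume "j \<in> {1..d - 1}"
  moreover have "f \<in> SB d"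
    using assms(2) by (simp add: sigma_cx_smallest_def)
  ultimately show "(\<Sum>i\<in>{i \<in> cube (d - 1). i j = 1}. coefficient (d - 1) (H d f) i) = 0"
    using sum_coef_containing[of f d j] by (simp add: sum_coefficient_H del: One_nat_def)
qed

end
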